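(* Let $d\ge 1$ be an integer and let $T$ be the complete binary tree of depth $d$. Then \[\frac{d-\log_2(d)-3-\log_2(3)}{2}\le \Phi_V(T)\le \lceil d/2\rceil .\]
   Context: The complete binary tree of depth $d$ is the rooted tree in which every vertex at distance less than $d$ from the root has exactly $2$ children, and the vertices at distance $d$ from the root are leaves. For a graph $G$ and $S\subseteq V(G)$, the vertex-border is $\delta(S)=\{v\in V(G)\setminus S : N(v)\cap S\neq\emptyset\}$. The vertex-isoperimetric parameter is $\Phi_V(G,s)=\min_{S\subseteq V(G),\,|S|=s}|\delta(S)|$, and the vertex-isoperimetric peak is $\Phi_V(G)=\max_{0\le s\le |V(G)|}\Phi_V(G,s)$. *)

theory Defs
  imports "Graph_Theory.Graph_Theory"
begin

text \<open>
  A finite simple graph is a symmetric digraph satisfying the locale \<^locale>\<open>graph\<close>: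
  the edge \<open>uv\<close> is the pair of opposite arcs between \<open>u\<close> and \<open>v\<close>.
\<close>

definition neighbourhood :: "('a, 'b) pre_digraph \<Rightarrow> 'a \<Rightarrow> 'a set" where
  "neighbourhood G v = {w. v \<rightarrow>\<^bsub>G\<^esub> w}"

definition vertex_border :: "('a, 'b) pre_digraph \<Rightarrow> 'a set \<Rightarrow> 'a set" where
  "vertex_border G S = {v \<in> verts G - S. neighbourhood G v \<inter> S \<noteq> {}}"

text \<open>
  For a finite graph the minimum and the maximum below range over finite sets, which are
  nonempty for \<open>s \<le> card (verts G)\<close>; elsewhere the value is unspecified.
\<close>

definition vertex_isoperimetric :: "('a, 'b) pre_digraph \<Rightarrow> nat \<Rightarrow> nat" where
  "vertex_isoperimetric G s =
     Min ((\<lambda>S. card (vertex_border G S)) ` {S. S \<subseteq> verts G \<and> card S = s})"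

definition vertex_isoperimetric_peak :: "('a, 'b) pre_digraph \<Rightarrow> nat" where
  "vertex_isoperimetric_peak G = Max (vertex_isoperimetric G ` {0..card (verts G)})"

text \<open>
  The library predicate \<^const>\<open>tree\<close> is meant for directed graphs: in a symmetric digraph the
  walk \<open>u, v, u\<close> is a \<^const>\<open>pre_digraph.cycle\<close>. The cycles of a simple graph are those of
  length at least 3.
\<close>

definition graph_tree :: "('a, 'b) pre_digraph \<Rightarrow> bool" where
  "graph_tree T \<longleftrightarrow> graph T \<and> Digraph_Component.connected T \<and>
     \<not> (\<exists>p. pre_digraph.cycle T p \<and> 3 \<le> length p)"

definition graph_dist :: "('a, 'b) pre_digraph \<Rightarrow> 'a \<Rightarrow> 'a \<Rightarrow> ereal" where
  "graph_dist G u v = wf_digraph.\<mu> G (\<lambda>_. 1) u v"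

definition children :: "('a, 'b) pre_digraph \<Rightarrow> 'a \<Rightarrow> 'a \<Rightarrow> 'a set" where
  "children T r v = {w \<in> neighbourhood T v. graph_dist T r w = graph_dist T r v + 1}"

definition complete_binary_tree :: "nat \<Rightarrow> ('a, 'b) pre_digraph \<Rightarrow> 'a \<Rightarrow> bool" where
  "complete_binary_tree d T r \<longleftrightarrow> graph_tree T \<and> r \<in> verts T \<and>
     (\<forall>v \<in> verts T. graph_dist T r v < ereal (real d) \<longrightarrow> card (children T r v) = 2) \<and>
     (\<forall>v \<in> verts T. graph_dist T r v = ereal (real d) \<longrightarrow> children T r v = {})"

end

theory Submission
  imports Defs
begin

text \<open>
  Upper bound: two levels at a time. If \<open>r\<close> has children \<open>a\<close> and \<open>b\<close>, collect the vertices in the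
  order: the two subtrees below \<open>a\<close>, then \<open>a\<close>, \<open>r\<close>, the two subtrees below \<open>b\<close>, and \<open>b\<close>. While a
  subtree is being swept, only its parent can be a border vertex outside of it, so two more
  levels cost one more border vertex.

  Lower bound: walking down from the root, membership in \<open>S\<close> changes only next to a border
  vertex, and a subtree of height \<open>h\<close> has \<open>2^(h+1) - 1\<close> vertices. Hence \<open>|S|\<close> is a sum of at most
  \<open>k + 1\<close> signed powers of two, up to an error of at most \<open>2 k + 1\<close>, where \<open>k\<close> is the size of the
  border. Take \<open>|S| = 2^m (4^q - 1) / 3 + 2^(m-1)\<close> with \<open>2^m\<close> of order \<open>d\<close> and \<open>2 q\<close> about \<open>d - m\<close>: the
  \<open>m\<close> low-order bits absorb the error, and \<open>(4^q - 1) / 3\<close>, with binary digits \<open>0101...01\<close>, is not a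
  sum of fewer than \<open>q\<close> signed powers of two.
\<close>

section \<open>Sums of signed powers of two\<close>

text \<open>\<open>zero\<close> is available for every \<open>k\<close>, so \<open>k\<close> only
  bounds the number of summands.\<close>

inductive signed_power_sum :: "nat \<Rightarrow> int \<Rightarrow> bool" where
  zero: "signed_power_sum k 0"
| plus: "signed_power_sum k n \<Longrightarrow> signed_power_sum (Suc k) (n + 2 ^ j)"
| minus: "signed_power_sum k n \<Longrightarrow> signed_power_sum (Suc k) (n - 2 ^ j)"

lemma signed_power_sum_Suc: "signed_power_sum k n \<Longrightarrow> signed_power_sum (Suc k) n"
  by (induction rule: signed_power_sum.induct) (auto intro: signed_power_sum.intros)

lemma signed_power_sum_mono: "signed_power_sum j n \<Longrightarrow> j \<le> k \<Longrightarrow> signed_power_sum k n"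
  by (induction k) (auto simp: le_Suc_eq intro: signed_power_sum_Suc)

lemma signed_power_sum_add:
  assumes "signed_power_sum j m" "signed_power_sum k n"
  shows "signed_power_sum (j + k) (m + n)"
  using assms(1)
proof (induction rule: signed_power_sum.induct)
  case (zero j)
  then show ?case using signed_power_sum_mono[OF assms(2)] by simp
next
  case (plus j m i)
  then show ?case using signed_power_sum.plus[of "j + k" "m + n" i] by (simp add: algebra_simps)
next
  case (minus j m i)
  then show ?case using signed_power_sum.minus[of "j + k" "m + n" i] by (simp add: algebra_simps)
qed

text \<open>Halving turns \<open>2 ^ Suc i\<close> into \<open>2 ^ i\<close>. A summand
  \<open>2 ^ 0\<close> disappears in the rounding or survives as a carry of the same size, so no
  summand is gained.\<close>

lemma signed_power_sum_div2: "signed_power_sum k n \<Longrightarrow> signed_power_sum k (n div 2)"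
proof (induction rule: signed_power_sum.induct)
  case (zero k)
  then show ?case by (simp add: signed_power_sum.zero)
next
  case (plus k n j)
  show ?case
  proof (cases j)
    case 0
    then have "(n + 2 ^ j) div 2 = n div 2 \<or> (n + 2 ^ j) div 2 = n div 2 + 2 ^ 0" by simp presburger
    then show ?thesis
      using plus.IH signed_power_sum_Suc signed_power_sum.plus by metis
  next
    case (Suc i)
    then have "(n + 2 ^ j) div 2 = n div 2 + 2 ^ i" by simp
    then show ?thesis using plus.IH signed_power_sum.plus by metis
  qed
next
  case (minus k n j)
  show ?case
  proof (cases j)
    case 0
    then have "(n - 2 ^ j) div 2 = n div 2 \<or> (n - 2 ^ j) div 2 = n div 2 - 2 ^ 0" by simp presburger
    then show ?thesis
      using minus.IH signed_power_sum_Suc signed_power_sum.minus by metis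
  next
    case (Suc i)
    have "(n - 2 ^ j) div 2 = (n + (- (2 ^ i)) * 2) div 2" using Suc by simp
    also have "\<dots> = n div 2 - 2 ^ i" by (subst div_mult_self1) auto
    finally show ?thesis using minus.IH signed_power_sum.minus by metis
  qed
qed

lemma signed_power_sum_div_power2:
  "signed_power_sum k n \<Longrightarrow> signed_power_sum k (n div 2 ^ m)"
proof (induction m)
  case (Suc m)
  have "n div 2 ^ Suc m = n div 2 ^ m div 2"
    by (simp add: zdiv_zmult2_eq[symmetric] mult.commute)
  then show ?case using Suc signed_power_sum_div2 by metis
qed simp

text \<open>Parity forces a summand 1 or -1. Taking it away frees one summand before the rest is
  halved.\<close>

lemma signed_power_sum_odd:
  assumes "signed_power_sum k n" "odd n"
  shows "\<exists>l. k = Suc l \<and>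
    (signed_power_sum l ((n - 1) div 2) \<or> signed_power_sum l ((n + 1) div 2))"
  using assms
proof (induction rule: signed_power_sum.induct)
  case (zero k)
  then show ?case by simp
next
  case (plus k n j)
  show ?case
  proof (cases j)
    case 0
    then show ?thesis using signed_power_sum_div2[OF plus.hyps] by simp
  next
    case (Suc i)
    then have "odd n" using plus.prems by simp
    then obtain l where l: "k = Suc l"
      "signed_power_sum l ((n - 1) div 2) \<or> signed_power_sum l ((n + 1) div 2)"
      using plus.IH by blast
    have "(n + 2 ^ j - 1) div 2 = (n - 1) div 2 + 2 ^ i" "(n + 2 ^ j + 1) div 2 = (n + 1) div 2 + 2 ^ i"
      using Suc \<open>odd n\<close> by (auto elim!: oddE)
    then show ?thesis using l signed_power_sum.plus by metis
  qed
next
  case (minus k n j)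
  show ?case
  proof (cases j)
    case 0
    then show ?thesis using signed_power_sum_div2[OF minus.hyps] by simp
  next
    case (Suc i)
    then have "odd n" using minus.prems by simp
    then obtain l where l: "k = Suc l"
      "signed_power_sum l ((n - 1) div 2) \<or> signed_power_sum l ((n + 1) div 2)"
      using minus.IH by blast
    have "(n - 2 ^ j - 1) div 2 = (n - 1) div 2 - 2 ^ i" "(n - 2 ^ j + 1) div 2 = (n + 1) div 2 - 2 ^ i"
      using Suc \<open>odd n\<close> by (auto elim!: oddE)
    then show ?thesis using l signed_power_sum.minus by metis
  qed
qed

text \<open>Removing the odd summand and halving leaves \<open>2 * n\<close> or
  \<open>2 * n + 1\<close>; a second halving sends both to \<open>n\<close>. Two binary digits thus
  cost one summand.\<close>

lemma signed_power_sum_4x1: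
  assumes "signed_power_sum k (4 * n + 1)"
  shows "\<exists>l. k = Suc l \<and> signed_power_sum l n"
proof -
  have "(4 * n + 1 - 1) div 2 = 2 * n" "(4 * n + 1 + 1) div 2 = 2 * n + 1" by auto
  then obtain l where l: "k = Suc l"
    "signed_power_sum l (2 * n) \<or> signed_power_sum l (2 * n + 1)"
    using signed_power_sum_odd[OF assms] by (metis dvd_triv_left even_numeral even_plus_one_iff even_mult_iff)
  have "(2 * n) div 2 = n" "(2 * n + 1) div 2 = n" by auto
  with l show ?thesis using signed_power_sum_div2 by metis
qed

section \<open>A number that needs many signed powers of two\<close>

primrec alternating_bits :: "nat \<Rightarrow> nat" where
  "alternating_bits 0 = 0"
| "alternating_bits (Suc q) = 4 * alternating_bits q + 1"

lemma alternating_bits_less: "2 * alternating_bits q < 4 ^ q"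
  by (induction q) auto

lemma signed_power_sum_alternating_bits:
  "signed_power_sum k (int (alternating_bits q)) \<Longrightarrow> q \<le> k"
proof (induction q arbitrary: k)
  case (Suc q)
  then have "signed_power_sum k (4 * int (alternating_bits q) + 1)" by (simp add: algebra_simps)
  then show ?case using Suc.IH signed_power_sum_4x1 by fastforce
qed simp

text \<open>One parameter bounds both the number of summands and, at two per unit, the error, so
  that both add up over disjoint subtrees with \<open>k\<close> counting border vertices.\<close>

definition near_signed_power_sum :: "nat \<Rightarrow> int \<Rightarrow> bool" where
  "near_signed_power_sum k n \<longleftrightarrow> (\<exists>c. \<bar>c\<bar> \<le> 2 * int k \<and> signed_power_sum k (n - c))"

lemma near_signed_power_sum_0: "near_signed_power_sum k 0"
  unfolding near_signed_power_sum_def by (rule exI[of _ 0]) (simp add: signed_power_sum.zero)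

lemma near_signed_power_sum_add:
  assumes "near_signed_power_sum j m" "near_signed_power_sum k n"
  shows "near_signed_power_sum (j + k) (m + n)"
proof -
  obtain b c where "\<bar>b\<bar> \<le> 2 * int j" "signed_power_sum j (m - b)"
    "\<bar>c\<bar> \<le> 2 * int k" "signed_power_sum k (n - c)"
    using assms unfolding near_signed_power_sum_def by blast
  then show ?thesis unfolding near_signed_power_sum_def
    by (intro exI[of _ "b + c"])
      (use signed_power_sum_add[of j "m - b" k "n - c"] in \<open>auto simp: algebra_simps\<close>)
qed

text \<open>This and the next two cover what a single border vertex can contribute: a small
  constant, possibly with one power of either sign.\<close>

lemma near_signed_power_sum_const: "\<bar>c\<bar> \<le> 2 \<Longrightarrow> near_signed_power_sum 1 c"
  unfolding near_signed_power_sum_def by (rule exI[of _ c]) (simp add: signed_power_sum.zero)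

lemma near_signed_power_sum_plus: "\<bar>c\<bar> \<le> 2 \<Longrightarrow> near_signed_power_sum 1 (2 ^ j + c)"
  unfolding near_signed_power_sum_def
  using signed_power_sum.plus[OF signed_power_sum.zero, of 0 j] by (intro exI[of _ c]) simp

lemma near_signed_power_sum_minus: "\<bar>c\<bar> \<le> 2 \<Longrightarrow> near_signed_power_sum 1 (- (2 ^ j) + c)"
  unfolding near_signed_power_sum_def
  using signed_power_sum.minus[OF signed_power_sum.zero, of 0 j] by (intro exI[of _ c]) simp

section \<open>Borders in complete binary trees\<close>

text \<open>
  \<open>binary_tree E h v D\<close>: the set \<open>D\<close> induces a complete binary tree of depth \<open>h\<close> with root \<open>v\<close>.
  The whole vertex set may have further edges, but only at \<open>v\<close>; this is imposed by the parent tree.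
\<close>

inductive binary_tree :: "('a \<Rightarrow> 'a \<Rightarrow> bool) \<Rightarrow> nat \<Rightarrow> 'a \<Rightarrow> 'a set \<Rightarrow> bool"
  for E :: "'a \<Rightarrow> 'a \<Rightarrow> bool" where
  leaf: "binary_tree E 0 v {v}"
| node: "\<lbrakk>binary_tree E h a A; binary_tree E h b B; E v a; E v b; v \<notin> A; v \<notin> B; A \<inter> B = {};
    \<And>x y. x \<in> A \<Longrightarrow> E x y \<Longrightarrow> y \<notin> A \<Longrightarrow> x = a \<and> y = v;
    \<And>x y. x \<in> B \<Longrightarrow> E x y \<Longrightarrow> y \<notin> B \<Longrightarrow> x = b \<and> y = v\<rbrakk>
    \<Longrightarrow> binary_tree E (Suc h) v (insert v (A \<union> B))"

lemma binary_tree_root: "binary_tree E h v D \<Longrightarrow> v \<in> D"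
  by (induction rule: binary_tree.induct) auto

lemma binary_tree_subset:
  "binary_tree E h v D \<Longrightarrow> v \<in> V \<Longrightarrow> (\<And>x y. E x y \<Longrightarrow> y \<in> V) \<Longrightarrow> D \<subseteq> V"
proof (induction rule: binary_tree.induct)
  case (node h a A b B v)
  then have "a \<in> V" "b \<in> V" by blast+
  then show ?case using node by auto
qed auto

lemma binary_tree_finite: "binary_tree E h v D \<Longrightarrow> finite D"
  by (induction rule: binary_tree.induct) auto

lemma binary_tree_card: "binary_tree E h v D \<Longrightarrow> card D = 2 ^ Suc h - 1"
proof (induction rule: binary_tree.induct)
  case (node h a A b B v)
  have "card (insert v (A \<union> B)) = Suc (card A + card B)"
    using node.hyps(1,2,5-7) by (simp add: card_Un_disjoint binary_tree_finite)
  also have "\<dots> = 2 ^ Suc (Suc h) - 1"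
  proof -
    have "(1::nat) \<le> 2 ^ h" by simp
    then show ?thesis unfolding node.IH power_Suc by linarith
  qed
  finally show ?case .
qed simp

text \<open>
  At a border vertex both values of \<open>p\<close> are allowed: there the set may change between \<open>S\<close> and its
  complement, and the border vertex pays for that change.
\<close>

lemma binary_tree_near_signed_power_sum:
  assumes "binary_tree E h v D" "symp E" "S \<inter> B = {}"
    and border: "\<And>x y. E x y \<Longrightarrow> x \<in> S \<Longrightarrow> y \<in> S \<union> B"
    and "v \<in> B \<or> (p \<longleftrightarrow> v \<in> S)"
  shows "near_signed_power_sum (card (D \<inter> B)) (int (card (D \<inter> S)) - of_bool p * (2 ^ Suc h - 1))"
  using assms(1,5)
proof (induction arbitrary: p rule: binary_tree.induct)
  case (leaf v)
  have "card ({v} \<inter> S) = of_bool (v \<in> S)" "card ({v} \<inter> B) = of_bool (v \<in> B)" by auto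
  moreover have "near_signed_power_sum (of_bool (v \<in> B)) (of_bool (v \<in> S) - of_bool p)"
  proof (cases "v \<in> B")
    case True
    then show ?thesis by (simp only: of_bool_eq True, intro near_signed_power_sum_const) simp
  next
    case False
    then show ?thesis using leaf by (simp add: near_signed_power_sum_0)
  qed
  ultimately show ?case by simp
next
  case (node h a A b C v)
  have fin: "finite A" "finite C" using node.hyps(1,2) by (simp_all add: binary_tree_finite)
  have card: "card (insert v (A \<union> C) \<inter> X) = of_bool (v \<in> X) + card (A \<inter> X) + card (C \<inter> X)" for X
  proof -
    have "insert v (A \<union> C) \<inter> X = ({v} \<inter> X) \<union> ((A \<inter> X) \<union> (C \<inter> X))" by auto
    also have "card \<dots> = card ({v} \<inter> X) + card ((A \<inter> X) \<union> (C \<inter> X))"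
      using fin node.hyps(5-7) by (intro card_Un_disjoint) auto
    also have "card ((A \<inter> X) \<union> (C \<inter> X)) = card (A \<inter> X) + card (C \<inter> X)"
      using fin node.hyps(5-7) by (intro card_Un_disjoint) auto
    finally show ?thesis by (simp add: Int_insert_left)
  qed
  have E: "E v a" "E a v" "E v b" "E b v" using node.hyps(3,4) \<open>symp E\<close> by (auto dest: sympD)
  have both: "near_signed_power_sum (card (A \<inter> B) + card (C \<inter> B))
      (int (card (A \<inter> S)) + int (card (C \<inter> S)) - (of_bool x + of_bool y) * (2 ^ Suc h - 1))"
    if "a \<in> B \<or> (x \<longleftrightarrow> a \<in> S)" "b \<in> B \<or> (y \<longleftrightarrow> b \<in> S)" for x y
    using near_signed_power_sum_add[OF node.IH(1)[OF that(1)] node.IH(2)[OF that(2)]]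
    by (simp add: algebra_simps)
  show ?case
  proof (cases "v \<in> B")
    case True
    then have "v \<notin> S" using \<open>S \<inter> B = {}\<close> by auto
    \<comment> \<open>Each child gets its actual membership in \<open>S\<close> as its value of
      \<open>p\<close>; the mismatch with the value \<open>p\<close> at \<open>v\<close> is the last
      summand, charged to \<open>v\<close>.\<close>
    have eq: "int (card (insert v (A \<union> C) \<inter> S)) - of_bool p * (2 ^ Suc (Suc h) - 1) =
      (int (card (A \<inter> S)) + int (card (C \<inter> S)) -
        (of_bool (a \<in> S) + of_bool (b \<in> S)) * (2 ^ Suc h - 1)) +
      ((of_bool (a \<in> S) + of_bool (b \<in> S)) * (2 ^ Suc h - 1) -
        of_bool p * (2 ^ Suc (Suc h) - 1))"
      unfolding card using \<open>v \<notin> S\<close> by simp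
    \<comment> \<open>With \<open>P = 2 ^ Suc h\<close> the six values are 0, \<open>P - 1\<close>,
      \<open>2 * P - 2\<close> if \<open>p\<close> is false and \<open>1 - 2 * P\<close>,
      \<open>- P\<close>, \<open>-1\<close> if it is true: each is 0 or a signed power, plus a
      constant of size at most 2. This fixes the error allowance.\<close>
    have "near_signed_power_sum 1 ((of_bool (a \<in> S) + of_bool (b \<in> S)) * (2 ^ Suc h - 1) -
        of_bool p * (2 ^ Suc (Suc h) - 1))"
      using near_signed_power_sum_const[of 0] near_signed_power_sum_const[of "-1"]
        near_signed_power_sum_plus[of "-1" "Suc h"] near_signed_power_sum_plus[of "-2" "Suc (Suc h)"]
        near_signed_power_sum_minus[of "1" "Suc (Suc h)"] near_signed_power_sum_minus[of "0" "Suc h"]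
      by (cases "a \<in> S"; cases "b \<in> S"; cases p) (simp_all add: algebra_simps)
    from near_signed_power_sum_add[OF both this, of "a \<in> S" "b \<in> S"]
    show ?thesis unfolding eq unfolding card using True by simp
  next
    case False
    then have p: "p \<longleftrightarrow> v \<in> S" using node.prems by blast
    \<comment> \<open>An edge between \<open>S\<close> and its complement ends outside
      \<open>S\<close> in a border vertex. As \<open>v\<close> is none, a child whose membership
      differs must lie in \<open>B\<close>.\<close>
    have "a \<in> B \<or> (p \<longleftrightarrow> a \<in> S)" "b \<in> B \<or> (p \<longleftrightarrow> b \<in> S)"
      using p False E border by blast+
    from both[OF this] show ?thesis
      unfolding card using False p by (simp add: algebra_simps)
  qed
qed

section \<open>Borders relative to a vertex set, and the lower bound\<close>

definition border_in :: "('a \<Rightarrow> 'a \<Rightarrow> bool) \<Rightarrow> 'a set \<Rightarrow> 'a set \<Rightarrow> 'a set" where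
  "border_in E D S = {v \<in> D - S. \<exists>w\<in>S. E v w}"

text \<open>\<open>m\<close> low-order bits are reserved for the error and \<open>q\<close> blocks
  \<open>01\<close> sit above them. The bound on \<open>m + 2 * q\<close> makes the size fit into
  the tree; the bound on \<open>2 * q\<close> keeps the error below \<open>2 ^ (m - 1)\<close> when
  the border has fewer than \<open>q - 1\<close> vertices.\<close>

lemma binary_tree_border_lower:
  assumes T: "binary_tree E d r D" and "symp E" and closed: "\<And>x y. E x y \<Longrightarrow> y \<in> D"
    and m: "1 \<le> m" "m + 2 * q \<le> d + 2" "1 \<le> q" "2 * q \<le> 2 ^ (m - 1) + 2"
  shows "\<exists>s \<le> card D. \<forall>S \<subseteq> D. card S = s \<longrightarrow> q \<le> Suc (card (border_in E D S))"
proof -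
  \<comment> \<open>The term \<open>2 ^ (m - 1)\<close> puts \<open>s\<close> in the middle of a
    block of \<open>2 ^ m\<close> integers, so a smaller error of either sign does not leave the
    block.\<close>
  define s where "s = 2 ^ m * alternating_bits q + 2 ^ (m - 1)"
  have half: "(2::nat) ^ m = 2 * 2 ^ (m - 1)" using m(1) by (cases m) auto
  have half_pos: "(0::nat) < 2 ^ (m - 1)" by simp
  have "alternating_bits q + 1 \<le> 2 ^ (2 * q - 1)"
  proof -
    have "(4::nat) ^ q = 2 ^ (2 * q)" by (simp add: power_mult)
    also have "\<dots> = 2 * 2 ^ (2 * q - 1)" using m(3) by (cases q) auto
    finally show ?thesis using alternating_bits_less[of q] by simp
  qed
  then have "2 ^ m * (alternating_bits q + 1) \<le> 2 ^ m * 2 ^ (2 * q - 1)"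
    by (rule mult_left_mono) simp
  also have "\<dots> = 2 ^ (m + (2 * q - 1))" by (simp add: power_add)
  also have "\<dots> \<le> 2 ^ Suc d" using m by (intro power_increasing) auto
  finally have "s < 2 ^ Suc d"
    unfolding s_def half power_Suc distrib_left using half_pos by linarith
  then have "s \<le> card D" using binary_tree_card[OF T] by simp
  moreover have "q \<le> Suc (card (border_in E D S))" if S: "S \<subseteq> D" "card S = s" for S
  proof (rule ccontr)
    define k where "k = card (border_in E D S)"
    assume "\<not> q \<le> Suc (card (border_in E D S))"
    then have k: "Suc k < q" by (simp add: k_def)
    have "S \<inter> border_in E D S = {}" by (auto simp: border_in_def)
    moreover have "y \<in> S \<union> border_in E D S" if "E x y" "x \<in> S" for x y
      using that closed[OF that(1)] sympD[OF \<open>symp E\<close> that(1)] by (auto simp: border_in_def)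
    ultimately have "near_signed_power_sum (card (D \<inter> border_in E D S))
        (int (card (D \<inter> S)) - of_bool (r \<in> S) * (2 ^ Suc d - 1))"
      using binary_tree_near_signed_power_sum[OF T \<open>symp E\<close>] by blast
    moreover have "D \<inter> border_in E D S = border_in E D S" "D \<inter> S = S"
      using S by (auto simp: border_in_def)
    ultimately have "near_signed_power_sum k (int s - of_bool (r \<in> S) * (2 ^ Suc d - 1))"
      using S by (simp add: k_def)
    then obtain c where c: "\<bar>c\<bar> \<le> 2 * int k"
      "signed_power_sum k (int s - of_bool (r \<in> S) * (2 ^ Suc d - 1) - c)"
      unfolding near_signed_power_sum_def by blast
    \<comment> \<open>If the root is in \<open>S\<close>, the size of the full tree moves to the
      other side: its power is the extra summand, its \<open>- 1\<close> the extra unit of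
      error.\<close>
    have "\<exists>c. \<bar>c\<bar> \<le> 2 * int k + 1 \<and> signed_power_sum (Suc k) (int s - c)"
    proof (cases "r \<in> S")
      case True
      then show ?thesis using c signed_power_sum.plus[OF c(2), of "Suc d"]
        by (intro exI[of _ "c - 1"]) (auto simp: algebra_simps)
    next
      case False
      then show ?thesis using c signed_power_sum_Suc by (intro exI[of _ c]) auto
    qed
    then obtain c where c: "\<bar>c\<bar> \<le> 2 * int k + 1" "signed_power_sum (Suc k) (int s - c)" by blast
    have "int (2 * q) \<le> int (2 ^ (m - 1) + 2)" using m(4) by (simp only: of_nat_le_iff)
    then have "\<bar>c\<bar> < 2 ^ (m - 1)" using c(1) k by simp
    moreover have "int (2 ^ m) = int (2 * 2 ^ (m - 1))" using half by simp
    ultimately have "0 \<le> 2 ^ (m - 1) - c" "2 ^ (m - 1) - c < 2 ^ m" by auto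
    moreover have "int s - c = (2 ^ (m - 1) - c) + 2 ^ m * int (alternating_bits q)"
      by (simp add: s_def)
    ultimately have "(int s - c) div 2 ^ m = int (alternating_bits q)"
      by (simp only: div_mult_self2) (simp add: div_pos_pos_trivial)
    then have "signed_power_sum (Suc k) (int (alternating_bits q))"
      using signed_power_sum_div_power2[OF c(2), of m] by simp
    then have "q \<le> Suc k" by (rule signed_power_sum_alternating_bits)
    then show False using k by simp
  qed
  ultimately show ?thesis by blast
qed


section \<open>The upper bound by sweeping subtrees\<close>

text \<open>\<open>X\<close> is collected already and \<open>A\<close> is the subtree being swept.
  The exit \<open>p\<close> of \<open>A\<close> is also the only possible border vertex of
  \<open>X\<close>, so one vertex is enough beyond the border inside \<open>A\<close>.\<close>

lemma sweep_subtree: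
  assumes "symp E" "finite A" "A \<subseteq> D" "finite X" "X \<subseteq> D" "X \<inter> A = {}"
    and sets: "\<And>s. s \<le> card A \<Longrightarrow> \<exists>S\<subseteq>A. card S = s \<and> card (border_in E A S) \<le> k"
    and exit: "\<And>x y. x \<in> A \<Longrightarrow> E x y \<Longrightarrow> y \<notin> A \<Longrightarrow> y = p"
    and X: "border_in E D X \<subseteq> {p}"
    and s: "card X \<le> s" "s \<le> card X + card A"
  shows "\<exists>S\<subseteq>D. card S = s \<and> card (border_in E D S) \<le> Suc k"
proof -
  have "s - card X \<le> card A" using s by simp
  from sets[OF this] obtain S where
    S: "S \<subseteq> A" "card S = s - card X" "card (border_in E A S) \<le> k"
    by blast
  have "x = p \<or> x \<in> border_in E A S" if x: "x \<in> border_in E D (X \<union> S)" for x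
  proof -
    obtain w where w: "x \<in> D" "x \<notin> X" "x \<notin> S" "w \<in> X \<union> S" "E x w"
      using x by (auto simp: border_in_def)
    then have "E w x" using sympD[OF \<open>symp E\<close>] by simp
    show ?thesis
    proof (cases "w \<in> X")
      case True
      then show ?thesis using X w by (auto simp: border_in_def)
    next
      case False
      then show ?thesis using w S(1) exit[of w x] \<open>E w x\<close> by (auto simp: border_in_def)
    qed
  qed
  then have "border_in E D (X \<union> S) \<subseteq> insert p (border_in E A S)" by blast
  moreover have "finite (border_in E A S)" using \<open>finite A\<close> by (simp add: border_in_def)
  ultimately have "card (border_in E D (X \<union> S)) \<le> card (insert p (border_in E A S))"
    by (intro card_mono) auto
  also have "\<dots> \<le> Suc k"
    using S(3) card_insert_le_m1[of "Suc k" "border_in E A S" p] by simp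
  finally have "card (border_in E D (X \<union> S)) \<le> Suc k" .
  moreover have "card (X \<union> S) = s"
  proof -
    have "card (X \<union> S) = card X + card S"
      using assms(2,4,6) S(1) by (intro card_Un_disjoint) (auto intro: finite_subset)
    then show ?thesis using S(2) s by simp
  qed
  ultimately show ?thesis using assms(3,5) S(1) by (intro exI[of _ "X \<union> S"]) auto
qed

lemma border_in_subset_exit:
  assumes "symp E" "\<And>x y. x \<in> X \<Longrightarrow> E x y \<Longrightarrow> y \<in> D \<Longrightarrow> y \<notin> X \<Longrightarrow> y = p"
  shows "border_in E D X \<subseteq> {p}"
  using assms by (auto simp: border_in_def dest: sympD)

text \<open>The four subtrees two levels down are swept by induction, each at the price of one
  further border vertex: \<open>a\<close> for the first two, \<open>b\<close> for the last two.
  Heights 0 and 1 are the base cases.\<close>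

lemma binary_tree_border_upper:
  assumes "symp E"
  shows "binary_tree E h v D \<Longrightarrow> s \<le> card D \<Longrightarrow>
    \<exists>S\<subseteq>D. card S = s \<and> card (border_in E D S) \<le> Suc h div 2"
proof (induction h arbitrary: v D s rule: less_induct)
  case (less h)
  have full: ?case if "s = card D" using that by (intro exI[of _ D]) (simp add: border_in_def)
  show ?case
  proof (cases h)
    case 0
    then have "D = {v}" using less.prems(1) by (auto elim: binary_tree.cases)
    then show ?thesis using less.prems(2) full
      by (cases s) (auto intro!: exI[of _ "{}"] simp: border_in_def)
  next
    case (Suc g)
    from less.prems(1)[unfolded Suc] obtain a A b B where T:
      "D = insert v (A \<union> B)" "binary_tree E g a A" "binary_tree E g b B"
      "v \<notin> A" "v \<notin> B" "A \<inter> B = {}"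
      and exitA: "\<And>x y. x \<in> A \<Longrightarrow> E x y \<Longrightarrow> y \<notin> A \<Longrightarrow> x = a \<and> y = v"
      and exitB: "\<And>x y. x \<in> B \<Longrightarrow> E x y \<Longrightarrow> y \<notin> B \<Longrightarrow> x = b \<and> y = v"
      by (cases rule: binary_tree.cases) blast
    have fin: "finite A" "finite B" using T binary_tree_finite[of E] by simp_all
    have cardD: "card D = Suc (card A + card B)"
      using T(1,4,5,6) fin by (simp add: card_Un_disjoint)
    have borderA: "border_in E D A \<subseteq> {v}"
      by (rule border_in_subset_exit[OF assms]) (use exitA in blast)
    have border_empty: "border_in E D {} \<subseteq> {p}" for p by (simp add: border_in_def)
    show ?thesis
    proof (cases g)
      case 0
      \<comment> \<open>Here \<open>a\<close> and \<open>b\<close> are leaves, with no border inside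
        their own trees; \<open>v\<close> is the only possible border vertex and is added
        last.\<close>
      have sets: "\<exists>S\<subseteq>X. card S = s \<and> card (border_in E X S) \<le> 0"
        if "binary_tree E g x X" "s \<le> card X" for x X s
        using less.IH[OF _ that] Suc 0 by simp
      consider "s \<le> card A" | "card A \<le> s" "s \<le> card A + card B" | "s = card D"
        using less.prems(2) cardD by linarith
      then have "\<exists>S\<subseteq>D. card S = s \<and> card (border_in E D S) \<le> Suc 0"
      proof cases
        case 1
        show ?thesis
          by (rule sweep_subtree[OF assms fin(1) _ _ _ _ sets[OF T(2)] _ border_empty])
            (use 1 T(1) exitA in auto)
      next
        case 2
        show ?thesis
          by (rule sweep_subtree[OF assms fin(2) _ fin(1) _ T(6) sets[OF T(3)] _ borderA])
            (use 2 T(1) exitB in auto)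
      next
        case 3
        then show ?thesis by (intro exI[of _ D]) (simp add: border_in_def)
      qed
      then show ?thesis using Suc 0 by simp
    next
      case g: (Suc f)
      from T(2)[unfolded g] obtain a1 A1 a2 A2 where TA:
        "A = insert a (A1 \<union> A2)" "binary_tree E f a1 A1" "binary_tree E f a2 A2"
        "a \<notin> A1" "a \<notin> A2" "A1 \<inter> A2 = {}"
        and exitA1: "\<And>x y. x \<in> A1 \<Longrightarrow> E x y \<Longrightarrow> y \<notin> A1 \<Longrightarrow> x = a1 \<and> y = a"
        and exitA2: "\<And>x y. x \<in> A2 \<Longrightarrow> E x y \<Longrightarrow> y \<notin> A2 \<Longrightarrow> x = a2 \<and> y = a"
        by (cases rule: binary_tree.cases) blast
      from T(3)[unfolded g] obtain b1 B1 b2 B2 where TB: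
        "B = insert b (B1 \<union> B2)" "binary_tree E f b1 B1" "binary_tree E f b2 B2"
        "b \<notin> B1" "b \<notin> B2" "B1 \<inter> B2 = {}"
        and exitB1: "\<And>x y. x \<in> B1 \<Longrightarrow> E x y \<Longrightarrow> y \<notin> B1 \<Longrightarrow> x = b1 \<and> y = b"
        and exitB2: "\<And>x y. x \<in> B2 \<Longrightarrow> E x y \<Longrightarrow> y \<notin> B2 \<Longrightarrow> x = b2 \<and> y = b"
        by (cases rule: binary_tree.cases) blast
      define k where "k = Suc f div 2"
      have k: "Suc h div 2 = Suc k" using Suc g by (simp add: k_def)
      have sets: "\<exists>S\<subseteq>X. card S = s \<and> card (border_in E X S) \<le> k"
        if "binary_tree E f x X" "s \<le> card X" for x X s
        unfolding k_def using less.IH[OF _ that] Suc g by simp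
      have finA: "finite A1" "finite A2" and finB: "finite B1" "finite B2"
        using TA TB binary_tree_finite[of E] by simp_all
      have cardA: "card A = Suc (card A1 + card A2)"
        using TA(1,4,5,6) finA by (simp add: card_Un_disjoint)
      have cardB: "card B = Suc (card B1 + card B2)"
        using TB(1,4,5,6) finB by (simp add: card_Un_disjoint)
      define Y where "Y = insert v A"
      have cardY: "card Y = Suc (card A)" "card (Y \<union> B1) = Suc (card A + card B1)"
        "finite Y" "finite (Y \<union> B1)"
      proof -
        show "finite Y" using fin by (simp add: Y_def)
        show "finite (Y \<union> B1)" using fin finB by (simp add: Y_def)
        show Y: "card Y = Suc (card A)" using fin T(4) by (simp add: Y_def)
        have "card (Y \<union> B1) = card Y + card B1"
          using \<open>finite Y\<close> finB T(5,6) TB(1) by (intro card_Un_disjoint) (auto simp: Y_def)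
        then show "card (Y \<union> B1) = Suc (card A + card B1)" using Y by simp
      qed
      have borderA1: "border_in E D A1 \<subseteq> {a}"
        by (rule border_in_subset_exit[OF assms]) (use exitA1 in blast)
      \<comment> \<open>Edges from \<open>Y\<close> to the rest of \<open>D\<close> end in
        \<open>B\<close>, which is entered only at its root \<open>b\<close>.\<close>
      have borderY: "border_in E D Y \<subseteq> {b}"
      proof (rule border_in_subset_exit[OF assms])
        fix x y assume *: "x \<in> Y" "E x y" "y \<in> D" "y \<notin> Y"
        then have "y \<in> B" "E y x" using T(1) sympD[OF assms] by (auto simp: Y_def)
        moreover have "x \<notin> B" using *(1) T(5,6) by (auto simp: Y_def)
        ultimately show "y = b" using exitB by blast
      qed
      have borderYB1: "border_in E D (Y \<union> B1) \<subseteq> {b}"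
      proof (rule border_in_subset_exit[OF assms])
        fix x y assume *: "x \<in> Y \<union> B1" "E x y" "y \<in> D" "y \<notin> Y \<union> B1"
        show "y = b"
        proof (cases "x \<in> B1")
          case True
          then show ?thesis using exitB1 * by blast
        next
          case False
          then have "y \<in> border_in E D Y" using * sympD[OF assms] by (auto simp: border_in_def)
          then show ?thesis using borderY by blast
        qed
      qed
      have sub: "A1 \<subseteq> D" "A2 \<subseteq> D" "B1 \<subseteq> D" "B2 \<subseteq> D" "Y \<subseteq> D" "Y \<union> B1 \<subseteq> D"
        using T(1) TA(1) TB(1) by (auto simp: Y_def)
      have disj: "Y \<inter> B1 = {}" "(Y \<union> B1) \<inter> B2 = {}"
        using T(5,6) TB(1,6) by (auto simp: Y_def)
      \<comment> \<open>The two equations are the sizes at which \<open>a\<close> or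
        \<open>b\<close> completes its subtree; adding \<open>v\<close> starts the range from
        \<open>card Y\<close>.\<close>
      consider "s \<le> card A1" | "card A1 \<le> s" "s \<le> card A1 + card A2" | "s = card A"
        | "card Y \<le> s" "s \<le> card Y + card B1"
        | "card (Y \<union> B1) \<le> s" "s \<le> card (Y \<union> B1) + card B2" | "s = card D"
        using less.prems(2) cardD cardA cardB cardY by linarith
      then show ?thesis
      proof cases
        case 1
        show ?thesis unfolding k
          by (rule sweep_subtree[OF assms finA(1) sub(1) _ _ _ sets[OF TA(2)] _ border_empty])
            (use 1 exitA1 in auto)
      next
        case 2
        show ?thesis unfolding k
          by (rule sweep_subtree[OF assms finA(2) sub(2) finA(1) sub(1) TA(6) sets[OF TA(3)] _ borderA1])
            (use 2 exitA2 in auto)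
      next
        case 3
        have "card (border_in E D A) \<le> Suc k" using card_mono[OF _ borderA] by simp
        then show ?thesis unfolding k using 3 T(1) by blast
      next
        case 4
        show ?thesis unfolding k
          by (rule sweep_subtree[OF assms finB(1) sub(3) cardY(3) sub(5) disj(1) sets[OF TB(2)] _ borderY])
            (use 4 exitB1 in auto)
      next
        case 5
        show ?thesis unfolding k
          by (rule sweep_subtree[OF assms finB(2) sub(4) cardY(4) sub(6) disj(2) sets[OF TB(3)] _ borderYB1])
            (use 5 exitB2 in auto)
      next
        case 6
        then show ?thesis using full by simp
      qed
    qed
  qed
qed

section \<open>Levels in a tree\<close>

text \<open>The tree is assembled from level \<open>d\<close> upwards. Returning to \<open>v\<close>
  by iterating \<open>par\<close> is what separates sibling subtrees; the last clause supplies the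
  exit conditions of \<open>binary_tree.node\<close>.\<close>

lemma binary_tree_of_levels:
  fixes lev :: "'a \<Rightarrow> nat"
  assumes "symp E"
    and in_V: "\<And>u v. E u v \<Longrightarrow> v \<in> V"
    and adjacent: "\<And>u v. E u v \<Longrightarrow> lev v = Suc (lev u) \<or> lev u = Suc (lev v)"
    and parent: "\<And>u v. E u v \<Longrightarrow> lev v = Suc (lev u) \<Longrightarrow> u = par v"
    and inner: "\<And>v. v \<in> V \<Longrightarrow> lev v < d \<Longrightarrow> card {w. E v w \<and> lev w = Suc (lev v)} = 2"
    and outer: "\<And>v. v \<in> V \<Longrightarrow> lev v = d \<Longrightarrow> {w. E v w \<and> lev w = Suc (lev v)} = {}"
  shows "v \<in> V \<Longrightarrow> lev v + h = d \<Longrightarrow>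
    \<exists>D. binary_tree E h v D \<and> (\<forall>x\<in>D. lev v \<le> lev x \<and> (par ^^ (lev x - lev v)) x = v) \<and>
      (\<forall>x\<in>D. \<forall>y. E x y \<longrightarrow> y \<notin> D \<longrightarrow> x = v \<and> y = par v \<and> lev v = Suc (lev y))"
proof (induction h arbitrary: v)
  case 0
  have "y = par v \<and> lev v = Suc (lev y)" if "E v y" for y
    using that adjacent[OF that] parent sympD[OF \<open>symp E\<close> that] outer[OF 0(1)] 0(2) by auto
  then show ?case using binary_tree.leaf[of E v] by (intro exI[of _ "{v}"]) auto
next
  case (Suc h)
  obtain a b where ab: "{w. E v w \<and> lev w = Suc (lev v)} = {a, b}" "a \<noteq> b"
    using inner[OF Suc.prems(1)] Suc.prems(2) by (auto simp: card_2_iff)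
  then have a: "E v a" "lev a = Suc (lev v)" and b: "E v b" "lev b = Suc (lev v)" by auto
  have par: "par a = v" "par b = v" using parent a b by auto
  have V: "a \<in> V" "b \<in> V" using in_V a b by blast+
  obtain A where A: "binary_tree E h a A"
    "\<And>x. x \<in> A \<Longrightarrow> lev a \<le> lev x \<and> (par ^^ (lev x - lev a)) x = a"
    "\<And>x y. x \<in> A \<Longrightarrow> E x y \<Longrightarrow> y \<notin> A \<Longrightarrow> x = a \<and> y = par a"
    using Suc.IH[OF V(1)] a Suc.prems(2) by auto
  obtain B where B: "binary_tree E h b B"
    "\<And>x. x \<in> B \<Longrightarrow> lev b \<le> lev x \<and> (par ^^ (lev x - lev b)) x = b"
    "\<And>x y. x \<in> B \<Longrightarrow> E x y \<Longrightarrow> y \<notin> B \<Longrightarrow> x = b \<and> y = par b"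
    using Suc.IH[OF V(2)] b Suc.prems(2) by auto
  \<comment> \<open>The same number of \<open>par\<close> steps would send a common vertex to both
    \<open>a\<close> and \<open>b\<close>, whose levels agree.\<close>
  have disjoint: "A \<inter> B = {}" using A(2) B(2) a b \<open>a \<noteq> b\<close> by fastforce
  have v: "v \<notin> A" "v \<notin> B" using A(2)[of v] B(2)[of v] a b by auto
  let ?D = "insert v (A \<union> B)"
  have "binary_tree E (Suc h) v ?D"
    using A(1) B(1) a(1) b(1) v disjoint
    by (rule binary_tree.node) (use A(3) B(3) par in auto)
  moreover have "lev v \<le> lev x \<and> (par ^^ (lev x - lev v)) x = v" if "x \<in> ?D" for x
  proof -
    have "(par ^^ (lev x - lev v)) x = par ((par ^^ (lev x - Suc (lev v))) x)"
      if "Suc (lev v) \<le> lev x"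
      using that by (metis Suc_diff_Suc Suc_le_lessD comp_apply funpow.simps(2))
    then show ?thesis using that A(2)[of x] B(2)[of x] a b par by auto
  qed
  moreover have "x = v \<and> y = par v \<and> lev v = Suc (lev y)" if "x \<in> ?D" "E x y" "y \<notin> ?D" for x y
  proof -
    have x: "x = v" using that A(3)[of x y] B(3)[of x y] par by auto
    then have "lev y \<noteq> Suc (lev v)"
      using that ab binary_tree_root[OF A(1)] binary_tree_root[OF B(1)] by auto
    then have "lev v = Suc (lev y)" using adjacent[OF that(2)] x by auto
    then show ?thesis using parent[of y v] sympD[OF \<open>symp E\<close> that(2)] x by auto
  qed
  ultimately show ?case by blast
qed

section \<open>Cycles closed by a vertex with two connected neighbours\<close>

definition edges_within :: "('a, 'b) pre_digraph \<Rightarrow> 'a set \<Rightarrow> ('a \<times> 'a) set" where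
  "edges_within G D = {(x, y) \<in> arcs_ends G. x \<in> D \<and> y \<in> D}"

lemma (in wf_digraph) apath_within:
  assumes "(x, y) \<in> (edges_within G D)\<^sup>*" "x \<in> D" "x \<in> verts G"
  shows "\<exists>p. apath x p y \<and> set (awalk_verts x p) \<subseteq> D"
proof -
  have "\<exists>p. awalk x p y \<and> set (awalk_verts x p) \<subseteq> D"
    using assms(1)
  proof (induction rule: rtrancl_induct)
    case base
    then show ?case using assms by (intro exI[of _ "[]"]) (simp add: awalk_Nil_iff)
  next
    case (step y z)
    then obtain p where p: "awalk x p y" "set (awalk_verts x p) \<subseteq> D" by blast
    obtain e where e: "e \<in> arcs G" "tail G e = y" "head G e = z"
      using step(2) by (auto simp: edges_within_def)
    have "awalk y [e] z" using e by (auto simp: awalk_Cons_iff awalk_Nil_iff)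
    then have "awalk x (p @ [e]) z" using p by auto
    moreover have "set (awalk_verts x (p @ [e])) \<subseteq> D"
      using p(2) step(2) e set_awalk_verts_append[OF p(1) \<open>awalk y [e] z\<close>]
      by (auto simp: edges_within_def)
    ultimately show ?case by blast
  qed
  then obtain p where p: "awalk x p y" "set (awalk_verts x p) \<subseteq> D" by blast
  have "set (awalk_verts x (awalk_to_apath p)) \<subseteq> set (awalk_verts x p)"
    using awalk_to_apath_subset[OF p(1)] set_awalk_verts[OF p(1)]
      set_awalk_verts[OF awalkI_apath[OF apath_awalk_to_apath[OF p(1)]]] by auto
  then show ?thesis using p apath_awalk_to_apath[OF p(1)] by blast
qed

text \<open>If \<open>x\<close> and \<open>y\<close> differed, a simple path between them inside
  \<open>D\<close> would be nonempty and avoid \<open>v\<close>; the two edges at \<open>v\<close>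
  would close it to a cycle of length at least 3.\<close>

lemma (in wf_digraph) acyclic_neighbour_unique:
  assumes acyclic: "\<not> (\<exists>p. cycle p \<and> 3 \<le> length p)"
    and xy: "(x, y) \<in> (edges_within G D)\<^sup>*" "x \<in> D"
    and v: "v \<notin> D" "v \<rightarrow> x" "y \<rightarrow> v"
  shows "x = y"
proof (rule ccontr)
  assume "x \<noteq> y"
  obtain p where p: "apath x p y" "set (awalk_verts x p) \<subseteq> D"
    using apath_within[OF xy] adj_in_verts[OF v(2)] by blast
  then have "p \<noteq> []" using \<open>x \<noteq> y\<close> by (auto simp: apath_Nil_iff)
  obtain e where e: "e \<in> arcs G" "tail G e = v" "head G e = x" using v(2) by (rule reachableE)
  obtain f where f: "f \<in> arcs G" "tail G f = y" "head G f = v" using v(3) by (rule reachableE)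
  have walk: "awalk x p y" "distinct (awalk_verts x p)" using p(1) by (auto simp: apath_def)
  have "awalk y [f] v" using f by (auto simp: awalk_Cons_iff awalk_Nil_iff)
  then have pf: "awalk x (p @ [f]) v" using walk by auto
  then have "awalk v (e # p @ [f]) v" using e by (auto simp: awalk_Cons_iff)
  moreover have "awalk_verts x (p @ [f]) = awalk_verts x p @ [v]"
    using awalk_verts_append[OF pf] f by simp
  then have "distinct (tl (awalk_verts v (e # p @ [f])))"
    using e walk(2) p(2) v(1) by auto
  moreover have "3 \<le> length (e # p @ [f])" using \<open>p \<noteq> []\<close> by (cases p) auto
  ultimately show False using acyclic unfolding cycle_def by blast
qed

section \<open>Levels as distances from the root\<close>

definition level :: "('a, 'b) pre_digraph \<Rightarrow> 'a \<Rightarrow> 'a \<Rightarrow> nat" where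
  "level G r v = (LEAST n. \<exists>p. pre_digraph.awalk G r p v \<and> length p = n)"

context wf_digraph
begin

lemma level_le: "awalk r p v \<Longrightarrow> level G r v \<le> length p"
  unfolding level_def by (rule Least_le) blast

lemma level_awalk: "r \<rightarrow>\<^sup>* v \<Longrightarrow> \<exists>p. awalk r p v \<and> length p = level G r v"
  unfolding level_def reachable_awalk by (rule LeastI_ex) blast

lemma graph_dist_level:
  assumes "r \<rightarrow>\<^sup>* v"
  shows "graph_dist G r v = ereal (real (level G r v))"
proof -
  have cost: "awalk_cost (\<lambda>_. 1) p = real (length p)" for p :: "'b list"
    by (induction p) auto
  show ?thesis unfolding graph_dist_def \<mu>_def cost
  proof (rule antisym)
    obtain p where "awalk r p v" "length p = level G r v" using level_awalk[OF assms] by blast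
    then show "(INF p\<in>{p. awalk r p v}. ereal (real (length p))) \<le> ereal (real (level G r v))"
      by (intro INF_lower2[of p]) auto
    show "ereal (real (level G r v)) \<le> (INF p\<in>{p. awalk r p v}. ereal (real (length p)))"
      by (rule INF_greatest) (auto intro: level_le)
  qed
qed

lemma level_step:
  assumes "r \<rightarrow>\<^sup>* u" "u \<rightarrow> v"
  shows "level G r v \<le> Suc (level G r u)"
proof -
  obtain p where p: "awalk r p u" "length p = level G r u" using level_awalk[OF assms(1)] by blast
  obtain e where "e \<in> arcs G" "tail G e = u" "head G e = v" using assms(2) by auto
  then have "awalk u [e] v" by (auto simp: awalk_Cons_iff awalk_Nil_iff)
  then have "awalk r (p @ [e]) v" using p by auto
  from level_le[OF this] show ?thesis using p by simp
qed

lemma level_0: "r \<rightarrow>\<^sup>* v \<Longrightarrow> level G r v = 0 \<longleftrightarrow> v = r"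
  using level_awalk[of r v] level_le[of r "[]" r] by (auto simp: awalk_Nil_iff dest: reachable_in_verts)

text \<open>\<open>u\<close> is the last stop before \<open>v\<close> on a shortest walk: the prefix
  gives level at most \<open>n\<close>, and \<open>level_step\<close> excludes a smaller
  one.\<close>

lemma level_pred:
  assumes "r \<rightarrow>\<^sup>* v" "level G r v = Suc n"
  shows "\<exists>u. r \<rightarrow>\<^sup>* u \<and> u \<rightarrow> v \<and> level G r u = n"
proof -
  obtain p where p: "awalk r p v" "length p = Suc n" using level_awalk[OF assms(1)] assms(2) by auto
  then obtain q e where q: "p = q @ [e]" by (cases p rule: rev_cases) auto
  define u where "u = tail G e"
  have "awalk r q u" "u \<rightarrow> v"
    using p(1) unfolding q u_def by (auto simp: awalk_Cons_iff awalk_Nil_iff in_arcs_imp_in_arcs_ends)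
  moreover from this have "r \<rightarrow>\<^sup>* u" using reachable_awalk by blast
  moreover have "level G r u \<le> n" using level_le[OF \<open>awalk r q u\<close>] p(2) q by simp
  ultimately show ?thesis using level_step[of r u v] assms(2) by (intro exI[of _ u]) auto
qed

text \<open>Going back to the root along predecessors lowers the level, so the walk stays in the
  ball of radius \<open>n\<close>, which \<open>D\<close> contains.\<close>

lemma ball_connected:
  assumes "r \<rightarrow>\<^sup>* v" "level G r v \<le> n" "\<And>x. r \<rightarrow>\<^sup>* x \<Longrightarrow> level G r x \<le> n \<Longrightarrow> x \<in> D"
  shows "(r, v) \<in> (edges_within G D)\<^sup>*"
  using assms(1,2)
proof (induction "level G r v" arbitrary: v)
  case 0
  then show ?case using level_0 by auto
next
  case (Suc m)
  then obtain u where u: "r \<rightarrow>\<^sup>* u" "u \<rightarrow> v" "level G r u = m" using level_pred[of r v m] by auto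
  then have "(r, u) \<in> (edges_within G D)\<^sup>*" using Suc by auto
  moreover have "(u, v) \<in> edges_within G D"
    using u Suc assms(3) by (auto simp: edges_within_def)
  ultimately show ?case by (rule rtrancl_into_rtrancl)
qed

end

text \<open>In both parts \<open>v\<close> lies outside a set \<open>?D\<close> and has two
  neighbours joined inside it, which acyclicity forces to coincide. For two parents,
  \<open>?D\<close> is the ball just above \<open>v\<close>.\<close>

lemma (in graph) acyclic_level_structure:
  assumes acyclic: "\<not> (\<exists>p. cycle p \<and> 3 \<le> length p)"
    and reach: "\<And>v. v \<in> verts G \<Longrightarrow> r \<rightarrow>\<^sup>* v"
  shows acyclic_parent_unique: "\<And>u w v. u \<rightarrow> v \<Longrightarrow> w \<rightarrow> v \<Longrightarrow> level G r v = Suc (level G r u) \<Longrightarrow>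
      level G r v = Suc (level G r w) \<Longrightarrow> u = w"
    and acyclic_adjacent_level: "\<And>u v. u \<rightarrow> v \<Longrightarrow>
      level G r v = Suc (level G r u) \<or> level G r u = Suc (level G r v)"
proof -
  have sym: "y \<rightarrow> x" if "x \<rightarrow> y" for x y using arcs_ends_symmetric[OF sym_arcs that] .
  have within_sym: "sym ((edges_within G D)\<^sup>*)" for D
    by (rule sym_rtrancl) (auto simp: sym_def edges_within_def intro: sym)
  show parent: "u = w" if uw: "u \<rightarrow> v" "w \<rightarrow> v" "level G r v = Suc (level G r u)"
      "level G r v = Suc (level G r w)" for u w v
  proof -
    let ?D = "{x. level G r x \<le> level G r u}"
    have "(r, u) \<in> (edges_within G ?D)\<^sup>*" "(r, w) \<in> (edges_within G ?D)\<^sup>*"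
      using uw by (auto intro!: ball_connected[where n = "level G r u"] reach dest: adj_in_verts)
    then have "(u, w) \<in> (edges_within G ?D)\<^sup>*" using symD[OF within_sym] rtrancl_trans by metis
    then show ?thesis
      by (rule acyclic_neighbour_unique[OF acyclic, where v = v]) (use uw sym in auto)
  qed
  have not_same: "level G r u \<noteq> level G r v" if uv: "u \<rightarrow> v" for u v
  proof
    assume same: "level G r u = level G r v"
    have V: "r \<rightarrow>\<^sup>* u" "r \<rightarrow>\<^sup>* v" using adj_in_verts[OF uv] reach by auto
    have "u \<noteq> v" using adj_not_same uv by blast
    then have "level G r u \<noteq> 0" using same V level_0 by metis
    then obtain n where n: "level G r u = Suc n" using not0_implies_Suc by blast
    obtain p q where p: "r \<rightarrow>\<^sup>* p" "p \<rightarrow> u" "level G r p = n" and q: "r \<rightarrow>\<^sup>* q" "q \<rightarrow> v" "level G r q = n"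
      using level_pred[OF V(1) n] level_pred[OF V(2)] n same by auto
    \<comment> \<open>Adding \<open>u\<close> to the ball joins \<open>u\<close> to \<open>q\<close>
      by way of \<open>p\<close>, while \<open>v\<close>, on the level of \<open>u\<close>, stays
      outside. So \<open>u\<close> and \<open>q\<close> must coincide, although their levels
      differ.\<close>
    let ?D = "insert u {x. level G r x \<le> n}"
    have "(r, p) \<in> (edges_within G ?D)\<^sup>*" "(r, q) \<in> (edges_within G ?D)\<^sup>*"
      using p q by (auto intro!: ball_connected[where n = n])
    then have "(p, q) \<in> (edges_within G ?D)\<^sup>*" using symD[OF within_sym] rtrancl_trans by metis
    moreover have "(u, p) \<in> edges_within G ?D" using p sym by (auto simp: edges_within_def)
    ultimately have "(u, q) \<in> (edges_within G ?D)\<^sup>*" by (rule converse_rtrancl_into_rtrancl[rotated])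
    then have "u = q"
      by (rule acyclic_neighbour_unique[OF acyclic, where v = v])
        (use \<open>u \<noteq> v\<close> same n uv q sym in auto)
    then show False using n q by simp
  qed
  show "level G r v = Suc (level G r u) \<or> level G r u = Suc (level G r v)" if uv: "u \<rightarrow> v" for u v
    using level_step[of r u v] level_step[of r v u] not_same[OF uv] uv sym[OF uv] adj_in_verts[OF uv] reach
    by fastforce
qed

section \<open>From the graph to the inductive tree\<close>

lemma complete_binary_tree_imp_binary_tree:
  assumes "complete_binary_tree d T r"
  shows "binary_tree (dominates T) d r (verts T)"
proof -
  have T: "graph_tree T" "r \<in> verts T"
    and inner: "\<And>v. v \<in> verts T \<Longrightarrow> graph_dist T r v < ereal (real d) \<Longrightarrow> card (children T r v) = 2"
    and outer: "\<And>v. v \<in> verts T \<Longrightarrow> graph_dist T r v = ereal (real d) \<Longrightarrow> children T r v = {}"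
    using assms by (auto simp: complete_binary_tree_def)
  interpret graph T using T(1) by (simp add: graph_tree_def)
  have acyclic: "\<not> (\<exists>p. cycle p \<and> 3 \<le> length p)" using T(1) by (simp add: graph_tree_def)
  have reach: "r \<rightarrow>\<^sup>*\<^bsub>T\<^esub> v" if "v \<in> verts T" for v
    using T that by (auto simp: graph_tree_def connected_def strongly_connected_def
        reachable_mk_symmetric_eq[OF sym_arcs])
  have sym: "symp (dominates T)" using arcs_ends_symmetric[OF sym_arcs] by (auto intro: sympI)
  define lev where "lev = level T r"
  have dist: "graph_dist T r v = ereal (real (lev v))" if "v \<in> verts T" for v
    using graph_dist_level[OF reach[OF that]] by (simp add: lev_def)
  have children: "children T r v = {w. v \<rightarrow>\<^bsub>T\<^esub> w \<and> lev w = Suc (lev v)}" if "v \<in> verts T" for v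
    using that dist adj_in_verts by (fastforce simp: children_def neighbourhood_def one_ereal_def)
  \<comment> \<open>At the root no \<open>u\<close> qualifies and \<open>par r\<close> is arbitrary.
    This is harmless: the exit clause at \<open>r\<close> would require \<open>lev r\<close> to be
    positive.\<close>
  define par where "par v = (SOME u. u \<rightarrow>\<^bsub>T\<^esub> v \<and> lev v = Suc (lev u))" for v
  have parent: "u = par v" if "u \<rightarrow>\<^bsub>T\<^esub> v" "lev v = Suc (lev u)" for u v
  proof -
    have "par v \<rightarrow>\<^bsub>T\<^esub> v \<and> lev v = Suc (lev (par v))"
      unfolding par_def by (rule someI[of _ u]) (use that in blast)
    then show ?thesis
      using acyclic_parent_unique[OF acyclic reach] that unfolding lev_def by blast
  qed
  have adjacent: "lev v = Suc (lev u) \<or> lev u = Suc (lev v)" if "u \<rightarrow>\<^bsub>T\<^esub> v" for u v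
    using acyclic_adjacent_level[OF acyclic reach that] unfolding lev_def by blast
  have "lev r = 0" using level_0[OF reach[OF T(2)]] by (simp add: lev_def)
  have "\<exists>D. binary_tree (dominates T) d r D \<and>
      (\<forall>x\<in>D. lev r \<le> lev x \<and> (par ^^ (lev x - lev r)) x = r) \<and>
      (\<forall>x\<in>D. \<forall>y. x \<rightarrow>\<^bsub>T\<^esub> y \<longrightarrow> y \<notin> D \<longrightarrow> x = r \<and> y = par r \<and> lev r = Suc (lev y))"
    by (rule binary_tree_of_levels[OF sym, where V = "verts T" and d = d])
      (use adj_in_verts adjacent parent inner outer dist children T(2) \<open>lev r = 0\<close> in \<open>auto simp del: Collect_empty_eq\<close>)
  \<comment> \<open>Since \<open>lev r = 0\<close>, no edge leaves \<open>D\<close>; being closed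
    under edges, \<open>D\<close> contains everything reachable from \<open>r\<close>.\<close>
  then obtain D where D: "binary_tree (dominates T) d r D"
    "\<And>x y. x \<in> D \<Longrightarrow> x \<rightarrow>\<^bsub>T\<^esub> y \<Longrightarrow> y \<in> D"
    using \<open>lev r = 0\<close> by auto
  have "v \<in> D" if "r \<rightarrow>\<^sup>*\<^bsub>T\<^esub> v" for v
    using that by (induction rule: reachable_induct) (use D binary_tree_root in auto)
  moreover have "v \<in> verts T" if "v \<in> D" for v
    using binary_tree_subset[OF D(1) T(2)] adj_in_verts that by blast
  ultimately have "D = verts T" using reach by blast
  then show ?thesis using D(1) by simp
qed

section \<open>The isoperimetric peak\<close>

lemma vertex_border_eq_border_in: "vertex_border T S = border_in (dominates T) (verts T) S"
  by (auto simp: vertex_border_def border_in_def neighbourhood_def)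

lemma vertex_isoperimetric_le:
  assumes "finite (verts T)" "S \<subseteq> verts T" "card S = s"
  shows "vertex_isoperimetric T s \<le> card (vertex_border T S)"
  unfolding vertex_isoperimetric_def
  by (rule Min_le) (use assms in auto)

lemma vertex_isoperimetric_attained:
  assumes "finite (verts T)" "s \<le> card (verts T)"
  shows "\<exists>S \<subseteq> verts T. card S = s \<and> vertex_isoperimetric T s = card (vertex_border T S)"
proof -
  let ?M = "(\<lambda>S. card (vertex_border T S)) ` {S. S \<subseteq> verts T \<and> card S = s}"
  have "\<exists>S \<subseteq> verts T. card S = s" using obtain_subset_with_card_n[OF assms(2)] by metis
  then have "Min ?M \<in> ?M" using assms(1) by (intro Min_in) auto
  then show ?thesis unfolding vertex_isoperimetric_def by auto
qed

theorem theorem1p6: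
  fixes d :: nat and T :: "('a, 'b) pre_digraph" and r :: 'a
  assumes "1 \<le> d"
    and "complete_binary_tree d T r"
  shows "(real d - log 2 (real d) - 3 - log 2 3) / 2 \<le> real (vertex_isoperimetric_peak T)
    \<and> int (vertex_isoperimetric_peak T) \<le> \<lceil>real d / 2\<rceil>"
proof
  interpret graph T using assms(2) by (simp add: complete_binary_tree_def graph_tree_def)
  note tree = complete_binary_tree_imp_binary_tree[OF assms(2)]
  have sym: "symp (dominates T)" using arcs_ends_symmetric[OF sym_arcs] by (auto intro: sympI)
  have in_verts: "y \<in> verts T" if "x \<rightarrow>\<^bsub>T\<^esub> y" for x y using adj_in_verts[OF that] by simp
  have peak: "vertex_isoperimetric T s \<le> vertex_isoperimetric_peak T" if "s \<le> card (verts T)" for s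
    unfolding vertex_isoperimetric_peak_def by (rule Max_ge) (use that in auto)
  show "(real d - log 2 (real d) - 3 - log 2 3) / 2 \<le> real (vertex_isoperimetric_peak T)"
  proof -
    \<comment> \<open>The factor 12 serves twice: the right inequality gives
      \<open>3 * d < 2 ^ (m - 1)\<close>, ample for the error, and the left one gives
      \<open>m\<close> at most 2 + \<open>log 2 3\<close> + \<open>log 2 d\<close>, as in the
      claim.\<close>
    obtain m where m: "2 ^ m \<le> 12 * d" "12 * d < 2 ^ (m + 1)"
      using ex_power_ivl1[of 2 "12 * d"] assms(1) by auto
    have "real m \<le> log 2 (12 * real d)"
      by (rule le_log_of_power) (use m(1) of_nat_le_iff[of "2 ^ m" "12 * d", where ?'a = real] in auto)
    also have "\<dots> = log 2 4 + log 2 3 + log 2 (real d)"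
      using assms(1) log_mult[of 2 4 3] log_mult[of 2 12 "real d"] by simp
    also have "log 2 4 = (2::real)" using log_nat_power[of 2 2 2] by simp
    finally have log: "real m \<le> 2 + log 2 3 + log 2 (real d)" .
    show ?thesis
    proof (cases "m \<le> d")
      case False
      then have "real d - log 2 (real d) - 3 - log 2 3 \<le> 0" using log by simp
      then show ?thesis by simp
    next
      case True
      \<comment> \<open>The largest \<open>q\<close> with
        \<open>m + 2 * q \<le> d + 2\<close>.\<close>
      define q where "q = (d - m) div 2 + 1"
      have "1 \<le> m" using m(2) assms(1) by (cases m) auto
      have "12 * d < 4 * 2 ^ (m - 1)" using m(2) \<open>1 \<le> m\<close> by (cases m) auto
      moreover have "2 * q \<le> d + 2" "m + 2 * q \<le> d + 2" "1 \<le> q" using True by (simp_all add: q_def)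
      ultimately obtain s where s: "s \<le> card (verts T)" "\<And>S. S \<subseteq> verts T \<Longrightarrow> card S = s \<Longrightarrow>
          q \<le> Suc (card (border_in (dominates T) (verts T) S))"
        using binary_tree_border_lower[where q = q, OF tree sym _ \<open>1 \<le> m\<close>] in_verts by auto
      obtain S where "S \<subseteq> verts T" "card S = s" "vertex_isoperimetric T s = card (vertex_border T S)"
        using vertex_isoperimetric_attained[OF _ s(1)] by auto
      then have "q \<le> Suc (vertex_isoperimetric T s)"
        using s(2) by (simp add: vertex_border_eq_border_in)
      then have "(d - m) div 2 \<le> vertex_isoperimetric_peak T" using peak[OF s(1)] by (simp add: q_def)
      \<comment> \<open>The division loses at most 1, which with the 2 in the bound on
        \<open>m\<close> makes the 3 of the claim.\<close>
      then have "d \<le> m + 2 * vertex_isoperimetric_peak T + 1" by linarith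
      then have "real d \<le> real (m + 2 * vertex_isoperimetric_peak T + 1)" by (simp only: of_nat_le_iff)
      then show ?thesis using log by simp
    qed
  qed
  have "vertex_isoperimetric T s \<le> Suc d div 2" if "s \<le> card (verts T)" for s
  proof -
    obtain S where S: "S \<subseteq> verts T" "card S = s"
      "card (border_in (dominates T) (verts T) S) \<le> Suc d div 2"
      using binary_tree_border_upper[OF sym tree \<open>s \<le> card (verts T)\<close>] by blast
    then show ?thesis
      using vertex_isoperimetric_le[OF _ S(1,2)] by (simp add: vertex_border_eq_border_in)
  qed
  then have "vertex_isoperimetric_peak T \<le> Suc d div 2"
    unfolding vertex_isoperimetric_peak_def by (intro Max.boundedI) auto
  \<comment> \<open>An integer below \<open>d / 2 + 1\<close> is at most the ceiling of
    \<open>d / 2\<close>.\<close>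
  then have "real (vertex_isoperimetric_peak T) < real d / 2 + 1" by linarith
  then show "int (vertex_isoperimetric_peak T) \<le> \<lceil>real d / 2\<rceil>" by linarith
qed

end
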